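(* Consider a data set $\mathscr D_n=\{(x_i,y_i)\}_{i=1}^n$ of fixed sample size $n$, with $x_i\in\mathbb R^p$, $y_i\in\mathbb R$, $y_i=x_i'\theta_0+\varepsilon_i$, where $\theta_0\in\mathbb R^p$ has support $S_0$ of cardinality $s_0<n$. Suppose the normalizations $\mathbb E_n[x_{ij}^2]=1$ hold for each $j\le p$. Let $\hat S$ (with $\hat s=|\hat S|$) and $\hat\theta$ be the output of Simple Forward Regression with threshold $t$. Then $$\mathbb E_n[(x_i'\theta_0-x_i'\hat\theta)^2]^{1/2}\le (\hat s+s_0)^{1/2}\,\varphi_{\min}(\hat s+s_0)(G)^{-1/2}\left[2\|\mathbb E_n[x_i\varepsilon_i]\|_\infty+t^{1/2}\right].$$ In addition, for every integer $m\ge 0$ with $m\le|\hat S\setminus S_0|$ such that $t^{1/2}\ge 2\varphi_{\min}(m+s_0)(G)^{-1}\|\mathbb E_n[x_i\varepsilon_i]\|_\infty$, it holds that $$m\le 80\,\varphi_{\min}(m+s_0)(G)^{-4}\,s_0.$$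
   Context: Notation: $\mathbb E_n[\,\cdot\,]=\frac1n\sum_{i=1}^n(\cdot)$; $\ell(\theta)=\mathbb E_n[(y_i-x_i'\theta)^2]$ for $\theta\in\mathbb R^p$; for $S\subseteq\{1,\dots,p\}$, $\ell(S)=\min_{\theta:\mathrm{supp}(\theta)\subseteq S}\ell(\theta)$ and $\Delta_j\ell(S)=\ell(S\cup\{j\})-\ell(S)$. $G=\mathbb E_n[x_ix_i']$ is the empirical Gram matrix. For a symmetric $p\times p$ matrix $G$, the minimal $s$-sparse eigenvalue is $\varphi_{\min}(s)(G)=\min_{S\subseteq\{1,\dots,p\}:|S|\le s}\lambda_{\min}(G_S)$, where $G_S$ is the principal submatrix of $G$ with index set $S$. The disturbances $\varepsilon_i$ are arbitrary (the result is deterministic; it holds for every realization of the data). If a sparse eigenvalue appearing with a negative power is zero, an upper bound involving it is read as vacuous (equal to $+\infty$), and the condition on $t^{1/2}$ involving it is read as not satisfied. Simple Forward Regression (Algorithm 1) with user-chosen threshold $t>0$: initialize $\hat S=\varnothing$. For $k=1,\dots,p$: if $-\Delta_j\ell(\hat S)>t$ for some $j\in\{1,\dots,p\}\setminus\hat S$, choose $\hat j\in\arg\max\{-\Delta_j\ell(\hat S):-\Delta_j\ell(\hat S)>t\}$ and update $\hat S=\hat S\cup\{\hat j\}$; otherwise stop. Finally set $\hat\theta\in\arg\min_{\theta:\mathrm{supp}(\theta)\subseteq\hat S}\ell(\theta)$. *)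

theory Defs
  imports "HOL-Analysis.Analysis"
begin

text \<open>
  The sample is indexed by \<open>i \<in> {1..n}\<close> and the coordinates of \<open>\<real>\<^sup>p\<close> by a finite type \<open>'p\<close>,
  so \<open>p = CARD('p)\<close>.
\<close>

definition emp_mean :: "nat \<Rightarrow> (nat \<Rightarrow> 'b::real_vector) \<Rightarrow> 'b" where
  "emp_mean n f = (1 / real n) *\<^sub>R (\<Sum>i=1..n. f i)"

definition supp :: "real ^ 'p \<Rightarrow> 'p set" where
  "supp \<theta> = {j. \<theta> $ j \<noteq> 0}"

definition loss :: "nat \<Rightarrow> (nat \<Rightarrow> real ^ 'p) \<Rightarrow> (nat \<Rightarrow> real) \<Rightarrow> real ^ 'p \<Rightarrow> real" where
  "loss n x y \<theta> = emp_mean n (\<lambda>i. (y i - x i \<bullet> \<theta>)\<^sup>2)"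

text \<open>
  The infimum below is a minimum, since a least squares problem always has a solution.
\<close>

definition set_loss :: "nat \<Rightarrow> (nat \<Rightarrow> real ^ 'p) \<Rightarrow> (nat \<Rightarrow> real) \<Rightarrow> 'p set \<Rightarrow> real" where
  "set_loss n x y S = (INF \<theta>\<in>{\<theta>. supp \<theta> \<subseteq> S}. loss n x y \<theta>)"

definition incr_loss ::
  "nat \<Rightarrow> (nat \<Rightarrow> real ^ 'p) \<Rightarrow> (nat \<Rightarrow> real) \<Rightarrow> 'p \<Rightarrow> 'p set \<Rightarrow> real" where
  "incr_loss n x y j S = set_loss n x y (S \<union> {j}) - set_loss n x y S"

definition gram :: "nat \<Rightarrow> (nat \<Rightarrow> real ^ 'p) \<Rightarrow> real ^ 'p ^ 'p" where
  "gram n x = emp_mean n (\<lambda>i. \<chi> j k. x i $ j * x i $ k)"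

text \<open>
  \<open>principal_eigenvalue A S l\<close>: \<open>l\<close> is an eigenvalue of the principal submatrix \<open>A\<^sub>S\<close>.
  Vectors of \<open>\<real>\<^sup>S\<close> are functions of which only the values on \<open>S\<close> are used.
\<close>

definition principal_eigenvalue :: "real ^ 'p ^ 'p \<Rightarrow> 'p set \<Rightarrow> real \<Rightarrow> bool" where
  "principal_eigenvalue A S l \<longleftrightarrow>
    (\<exists>v :: 'p \<Rightarrow> real. (\<exists>j\<in>S. v j \<noteq> 0) \<and> (\<forall>j\<in>S. (\<Sum>k\<in>S. A $ j $ k * v k) = l * v j))"

definition principal_lambda_min :: "real ^ 'p ^ 'p \<Rightarrow> 'p set \<Rightarrow> real" where
  "principal_lambda_min A S = Min {l. principal_eigenvalue A S l}"

text \<open>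
  The empty submatrix has no eigenvalues, so \<open>S = {}\<close> does not take part in the minimum.
  Consequently \<open>sparse_eig_min 0 A\<close> is an unspecified real number.
\<close>

definition sparse_eig_min :: "nat \<Rightarrow> real ^ 'p ^ 'p \<Rightarrow> real" where
  "sparse_eig_min s A = Min {principal_lambda_min A S |S. S \<noteq> {} \<and> card S \<le> s}"

text \<open>
  \<open>forward_loop n x y t k S S'\<close>: with \<open>k\<close> passes of the loop left and current selection \<open>S\<close>,
  the loop can end with the selection \<open>S'\<close>. It is a relation because the argmax may be attained
  at several indices, any of which may be chosen.
\<close>

inductive forward_loop ::
  "nat \<Rightarrow> (nat \<Rightarrow> real ^ 'p) \<Rightarrow> (nat \<Rightarrow> real) \<Rightarrow> real \<Rightarrow> nat \<Rightarrow> 'p set \<Rightarrow> 'p set \<Rightarrow> bool"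
  for n x y t where
  finish: "forward_loop n x y t 0 S S"
| stop: "\<not> (\<exists>j. j \<notin> S \<and> - incr_loss n x y j S > t) \<Longrightarrow> forward_loop n x y t (Suc k) S S"
| select: "is_arg_max (\<lambda>j. - incr_loss n x y j S) (\<lambda>j. j \<notin> S \<and> - incr_loss n x y j S > t) j
    \<Longrightarrow> forward_loop n x y t k (S \<union> {j}) S' \<Longrightarrow> forward_loop n x y t (Suc k) S S'"

definition simple_forward_regression ::
  "nat \<Rightarrow> (nat \<Rightarrow> real ^ 'p) \<Rightarrow> (nat \<Rightarrow> real) \<Rightarrow> real \<Rightarrow> 'p set \<Rightarrow> real ^ 'p \<Rightarrow> bool" where
  "simple_forward_regression n x y t S \<theta> \<longleftrightarrow>
    forward_loop n x y t CARD('p) {} S \<and>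
    is_arg_min (loss n x y) (\<lambda>\<theta>. supp \<theta> \<subseteq> S) \<theta>"

end

theory Submission
  imports Defs
begin

text \<open>
  Prediction bound: at the output every residual correlation is at most \<open>\<surd>t\<close> in absolute value, so the
  squared prediction error is at most \<open>(\<nu> + \<surd>t) \<parallel>\<theta>0 - \<theta>hat\<parallel>\<^sub>1\<close> with
  \<open>\<nu> = \<parallel>E\<^sub>n[x\<^sub>i \<epsilon>\<^sub>i]\<parallel>\<^sub>\<infinity>\<close>; compare with the sparse eigenvalue.

  False selections: let \<open>Z = \<ell>(S) - \<ell>(\<theta>0)\<close>, and let \<open>A\<close>, \<open>B\<close> be the \<open>\<ell>\<^sub>1\<close> norm and the squared
  \<open>\<ell>\<^sub>2\<close> norm of \<open>\<theta>0\<close> outside \<open>S\<close>. A greedy step decreasing the loss by \<open>d\<close> satisfies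
  \<open>Z + \<phi> B \<le> 2 A \<surd>d\<close>, so a false selection, which keeps \<open>A\<close> and \<open>B\<close>, increases
  \<open>4 A\<^sup>2 / (Z + \<phi> B)\<close> by at least 1. While \<open>Z > 0\<close> this quantity is at most \<open>4 A\<^sup>2 / (\<phi> B)\<close>, and a
  true selection lowers it by at most \<open>4 / \<phi>\<close> times a term whose sum over all true selections is
  at most \<open>4 s\<^sub>0\<close> by Hardy's inequality. Hence at most \<open>1 + 16 s\<^sub>0 / \<phi>\<close> false selections start with
  \<open>Z > 0\<close>. Always \<open>Z \<ge> - \<phi> t (m + s\<^sub>0) / 4\<close>, and each step lowers \<open>Z\<close> by more than \<open>t\<close>, so at most
  \<open>\<phi> (m + s\<^sub>0) / 4\<close> of the first \<open>m\<close> false selections start with \<open>Z \<le> 0\<close>.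
\<close>

section \<open>Empirical means and vectors supported in a set\<close>

lemma emp_mean_mono: "(\<And>i. f i \<le> g i) \<Longrightarrow> emp_mean n f \<le> emp_mean n g" for f g :: "nat \<Rightarrow> real"
  by (auto simp: emp_mean_def intro!: divide_right_mono sum_mono)

lemma emp_mean_nonneg: "(\<And>i. 0 \<le> f i) \<Longrightarrow> 0 \<le> emp_mean n f" for f :: "nat \<Rightarrow> real"
  by (auto simp: emp_mean_def intro!: sum_nonneg divide_nonneg_nonneg)

lemma emp_mean_add: "emp_mean n (\<lambda>i. f i + g i) = emp_mean n f + emp_mean n g"
  by (simp add: emp_mean_def sum.distrib scaleR_add_right)

lemma emp_mean_mult_left: "emp_mean n (\<lambda>i. c * f i) = c * emp_mean n f" for f :: "nat \<Rightarrow> real"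
  by (simp add: emp_mean_def sum_distrib_left[symmetric])

lemma emp_mean_sum: "emp_mean n (\<lambda>i. \<Sum>j\<in>J. f j i) = (\<Sum>j\<in>J. emp_mean n (f j))"
  unfolding emp_mean_def scaleR_sum_right by (rule sum.swap)

lemma emp_mean_cong: "(\<And>i. i \<in> {1..n} \<Longrightarrow> f i = g i) \<Longrightarrow> emp_mean n f = emp_mean n g"
  unfolding emp_mean_def by (intro arg_cong[where f = "\<lambda>s. _ *\<^sub>R s"] sum.cong) auto

lemma inner_supp: "u \<bullet> v = (\<Sum>j\<in>S. u $ j * v $ j)" if "supp v \<subseteq> S" for u v :: "real ^ 'p"
  unfolding inner_vec_def inner_real_def
  by (rule sum.mono_neutral_right) (use that in \<open>auto simp: supp_def\<close>)

lemma norm_supp: "(norm v)\<^sup>2 = (\<Sum>j\<in>S. (v $ j)\<^sup>2)" if "supp v \<subseteq> S" for v :: "real ^ 'p"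
  unfolding power2_norm_eq_inner inner_supp[OF that] by (simp add: power2_eq_square)

lemma supp_subset_iff: "supp v \<subseteq> S \<longleftrightarrow> (\<forall>j. j \<notin> S \<longrightarrow> v $ j = 0)"
  by (auto simp: supp_def)

lemma closed_supp_subset: "closed {v :: real ^ 'p. supp v \<subseteq> S}"
proof -
  have "{v :: real ^ 'p. supp v \<subseteq> S} = (\<Inter>j\<in>-S. {v. v $ j = 0})"
    by (auto simp: supp_subset_iff)
  then show ?thesis
    by (auto intro!: closed_INT closed_Collect_eq continuous_intros)
qed

section \<open>Sparse eigenvalues as Rayleigh quotients\<close>

text \<open>First-order condition at a minimum: near \<open>c = 0\<close> the linear term dominates,
  and its sign can be chosen.\<close>

lemma nonneg_quadratic_linear_coeff:
  fixes a b :: real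
  assumes "\<And>c. 0 \<le> 2 * c * b + c\<^sup>2 * a"
  shows "b = 0"
proof (rule ccontr)
  assume b: "b \<noteq> 0"
  \<comment> \<open>\<open>a\<close> may be zero or negative, so it is replaced by a positive
    majorant \<open>k\<close>; \<open>c = - b / k\<close> then minimizes the resulting
    parabola.\<close>
  define k where "k = \<bar>a\<bar> + 1"
  have k: "k > 0" "a \<le> k" by (auto simp: k_def)
  define c where "c = - b / k"
  have "2 * c * b + c\<^sup>2 * a \<le> 2 * c * b + c\<^sup>2 * k"
    using k by (intro add_left_mono mult_left_mono) auto
  also have "\<dots> = - (b\<^sup>2 / k)"
    using k by (simp add: c_def power2_eq_square field_simps)
  also have "\<dots> < 0"
    using b k by simp
  finally show False using assms[of c] by linarith
qed

text \<open>Extension by zero turns eigenvectors of a principal submatrix into vectors of the full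
  space, where inner products and \<open>*v\<close> are available.\<close>

lemma principal_eigenvalue_iff:
  fixes A :: "real ^ 'p ^ 'p"
  shows "principal_eigenvalue A S l \<longleftrightarrow>
    (\<exists>v. v \<noteq> 0 \<and> supp v \<subseteq> S \<and> (\<forall>j\<in>S. (A *v v) $ j = l * v $ j))" (is "_ = ?R")
proof
  assume "principal_eigenvalue A S l"
  then obtain v where v: "\<exists>j\<in>S. v j \<noteq> 0" "\<And>j. j \<in> S \<Longrightarrow> (\<Sum>k\<in>S. A $ j $ k * v k) = l * v j"
    unfolding principal_eigenvalue_def by blast
  define w where "w = (\<chi> j. if j \<in> S then v j else 0)"
  have sw: "supp w \<subseteq> S" by (auto simp: supp_def w_def)
  have "(A *v w) $ j = (\<Sum>k\<in>S. A $ j $ k * v k)" for j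
    unfolding matrix_vector_mul_component inner_supp[OF sw] by (simp add: w_def)
  with v sw show ?R
    by (intro exI[of _ w]) (auto simp: w_def vec_eq_iff)
next
  assume ?R
  then obtain v where v: "v \<noteq> 0" "supp v \<subseteq> S" "\<And>j. j \<in> S \<Longrightarrow> (A *v v) $ j = l * v $ j"
    by blast
  moreover have "(A *v v) $ j = (\<Sum>k\<in>S. A $ j $ k * v $ k)" for j
    unfolding matrix_vector_mul_component inner_supp[OF v(2)] ..
  moreover have "\<exists>j\<in>S. v $ j \<noteq> 0"
    using v(1,2) by (auto simp: vec_eq_iff supp_def)
  ultimately show "principal_eigenvalue A S l"
    unfolding principal_eigenvalue_def by (intro exI[of _ "\<lambda>j. v $ j"]) auto
qed

lemma symmetric_matrix_inner: "transpose A = A \<Longrightarrow> (A *v u) \<bullet> v = u \<bullet> (A *v v)"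
  for A :: "real ^ 'p ^ 'p"
  by (metis dot_lmul_matrix vector_transpose_matrix)

text \<open>Eigenvectors for distinct eigenvalues are orthogonal, hence independent, hence finite in
  number. This makes \<open>Min\<close> in \<open>principal_lambda_min\<close> meaningful.\<close>

lemma finite_principal_eigenvalues:
  fixes A :: "real ^ 'p ^ 'p"
  assumes sym: "transpose A = A"
  shows "finite {l. principal_eigenvalue A S l}"
proof -
  define E where "E = {l. principal_eigenvalue A S l}"
  have "\<forall>l\<in>E. \<exists>v. v \<noteq> 0 \<and> supp v \<subseteq> S \<and> (\<forall>j\<in>S. (A *v v) $ j = l * v $ j)"
    by (simp add: E_def principal_eigenvalue_iff)
  from bchoice[OF this] obtain V where V:
    "\<And>l. l \<in> E \<Longrightarrow> V l \<noteq> 0 \<and> supp (V l) \<subseteq> S \<and> (\<forall>j\<in>S. (A *v V l) $ j = l * V l $ j)"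
    by blast
  \<comment> \<open>The eigenvalue equation is known only on \<open>S\<close>; that suffices because
    \<open>V k\<close> vanishes elsewhere.\<close>
  have inn: "(A *v V l) \<bullet> V k = l * (V l \<bullet> V k)" if "l \<in> E" "k \<in> E" for l k
    using V[OF that(1)] V[OF that(2)] inner_supp[of "V k" S]
    by (simp add: sum_distrib_left mult.assoc)
  have orth: "V l \<bullet> V k = 0" if "l \<in> E" "k \<in> E" "l \<noteq> k" for l k
  proof -
    have "l * (V l \<bullet> V k) = k * (V l \<bullet> V k)"
      using inn[OF that(1,2)] inn[OF that(2,1)] symmetric_matrix_inner[OF sym, of "V l" "V k"]
      by (simp add: inner_commute)
    then show ?thesis using that(3) by simp
  qed
  have inj: "inj_on V E"
    by (rule inj_onI) (metis V inner_eq_zero_iff orth)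
  have "pairwise orthogonal (V ` E)"
    by (auto simp: pairwise_def orthogonal_def intro: orth)
  moreover have "0 \<notin> V ` E" using V by auto
  ultimately have "independent (V ` E)"
    by (rule pairwise_orthogonal_independent)
  then have "finite (V ` E)" by (rule independent_imp_finite)
  with inj show ?thesis unfolding E_def[symmetric] by (simp add: finite_image_iff)
qed

text \<open>A minimizer of the quadratic form on the unit sphere of \<open>\<real>\<^sup>S\<close> is an eigenvector.\<close>

lemma least_principal_eigenvalue:
  fixes A :: "real ^ 'p ^ 'p"
  assumes sym: "transpose A = A" and "S \<noteq> {}"
  obtains l where "principal_eigenvalue A S l"
    and "\<And>w. supp w \<subseteq> S \<Longrightarrow> l * (norm w)\<^sup>2 \<le> w \<bullet> (A *v w)"
proof -
  define K where "K = {v :: real ^ 'p. supp v \<subseteq> S} \<inter> sphere 0 1"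
  obtain j0 where "j0 \<in> S" using assms(2) by blast
  then have "axis j0 1 \<in> K" by (auto simp: K_def supp_def axis_def norm_axis_1[unfolded axis_def])
  then have "K \<noteq> {}" by blast
  moreover have "compact K"
    unfolding K_def by (intro closed_Int_compact closed_supp_subset compact_sphere)
  moreover have "continuous_on K (\<lambda>v. v \<bullet> (A *v v))"
    by (intro continuous_intros)
  ultimately obtain v where v: "v \<in> K" and vmin: "\<And>u. u \<in> K \<Longrightarrow> v \<bullet> (A *v v) \<le> u \<bullet> (A *v u)"
    using continuous_attains_inf by metis
  define l where "l = v \<bullet> (A *v v)"
  have sv: "supp v \<subseteq> S" and nv: "norm v = 1" using v by (auto simp: K_def)
  have ray: "l * (norm w)\<^sup>2 \<le> w \<bullet> (A *v w)" if sw: "supp w \<subseteq> S" for w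
  proof (cases "w = 0")
    case False
    define u where "u = (1 / norm w) *\<^sub>R w"
    have "u \<in> K" using sw False by (auto simp: K_def u_def supp_subset_iff)
    from vmin[OF this] have "l \<le> u \<bullet> (A *v u)" by (simp add: l_def)
    also have "\<dots> = (w \<bullet> (A *v w)) / (norm w)\<^sup>2"
      by (simp add: u_def matrix_vector_mult_scaleR power2_eq_square)
    finally show ?thesis using False by (simp add: field_simps)
  qed simp
  have "(A *v v) $ j = l * v $ j" if j: "j \<in> S" for j
  proof -
    \<comment> \<open>This is \<open>ray\<close> for \<open>v\<close> perturbed along coordinate
      \<open>j\<close>. The constant terms cancel because \<open>l\<close> is the value of the form
      at the unit vector \<open>v\<close>; the coefficient of \<open>2 * c\<close> is the defect in
      the eigenvalue equation.\<close>
    have "0 \<le> 2 * c * ((A *v v) $ j - l * v $ j) + c\<^sup>2 * ((A *v axis j 1) $ j - l)" for c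
    proof -
      define w where "w = v + c *\<^sub>R axis j 1"
      have "supp w \<subseteq> S" using sv j by (auto simp: w_def supp_subset_iff axis_def)
      from ray[OF this] have "0 \<le> w \<bullet> (A *v w) - l * (w \<bullet> w)"
        by (simp add: power2_norm_eq_inner)
      also have "w \<bullet> (A *v w) = l + 2 * c * (A *v v) $ j + c\<^sup>2 * (A *v axis j 1) $ j"
      proof -
        have "v \<bullet> (A *v axis j 1) = (A *v v) $ j"
          using symmetric_matrix_inner[OF sym, of v "axis j 1"] by (simp add: inner_axis)
        then show ?thesis
          by (simp add: w_def l_def matrix_vector_right_distrib matrix_vector_mult_scaleR
              inner_add_left inner_add_right inner_axis' power2_eq_square algebra_simps)
      qed
      also have "w \<bullet> w = 1 + 2 * c * v $ j + c\<^sup>2"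
        using nv[unfolded norm_eq_1]
        by (simp add: w_def inner_add_left inner_add_right inner_axis inner_axis' power2_eq_square
            distrib_left)
      finally show ?thesis by (simp add: algebra_simps)
    qed
    from nonneg_quadratic_linear_coeff[OF this] show ?thesis by simp
  qed
  with sv nv have "principal_eigenvalue A S l"
    unfolding principal_eigenvalue_iff by (intro exI[of _ v]) auto
  with ray show thesis using that by blast
qed

lemma principal_lambda_min_le_Rayleigh:
  fixes A :: "real ^ 'p ^ 'p"
  assumes "transpose A = A" "S \<noteq> {}" "supp w \<subseteq> S"
  shows "principal_lambda_min A S * (norm w)\<^sup>2 \<le> w \<bullet> (A *v w)"
proof -
  obtain l where l: "principal_eigenvalue A S l" "l * (norm w)\<^sup>2 \<le> w \<bullet> (A *v w)"
    using least_principal_eigenvalue[OF assms(1,2)] assms(3) by metis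
  have "principal_lambda_min A S \<le> l"
    unfolding principal_lambda_min_def
    by (rule Min_le) (use finite_principal_eigenvalues[OF assms(1)] l in auto)
  then have "principal_lambda_min A S * (norm w)\<^sup>2 \<le> l * (norm w)\<^sup>2"
    by (rule mult_right_mono) simp
  with l(2) show ?thesis by linarith
qed

lemma principal_eigenvalue_lambda_min:
  fixes A :: "real ^ 'p ^ 'p"
  assumes "transpose A = A" "S \<noteq> {}"
  shows "principal_eigenvalue A S (principal_lambda_min A S)"
proof -
  have "principal_lambda_min A S \<in> {l. principal_eigenvalue A S l}"
    unfolding principal_lambda_min_def
    by (rule Min_in[OF finite_principal_eigenvalues[OF assms(1)]])
       (use least_principal_eigenvalue[OF assms] in blast)
  then show ?thesis by simp
qed

lemma finite_principal_lambda_mins: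
  "finite {principal_lambda_min A S |S :: 'p::finite set. S \<noteq> {} \<and> card S \<le> s}"
  by (rule finite_subset[of _ "range (principal_lambda_min A)"]) auto

lemma sparse_eig_min_le:
  "S \<noteq> {} \<Longrightarrow> card S \<le> s \<Longrightarrow> sparse_eig_min s A \<le> principal_lambda_min A S"
  unfolding sparse_eig_min_def by (rule Min_le[OF finite_principal_lambda_mins]) auto

lemma sparse_eig_min_attained:
  fixes A :: "real ^ 'p ^ 'p"
  assumes "s \<ge> 1"
  obtains S where "S \<noteq> {}" "sparse_eig_min s A = principal_lambda_min A S"
proof -
  \<comment> \<open>A singleton shows that the family under \<open>Min\<close> is nonempty; this is
    where \<open>s \<ge> 1\<close> enters.\<close>
  have "principal_lambda_min A {undefined} \<in> {principal_lambda_min A S |S. S \<noteq> {} \<and> card S \<le> s}"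
    using assms by (auto intro!: exI[of _ "{undefined}"])
  then have "sparse_eig_min s A \<in> {principal_lambda_min A S |S. S \<noteq> {} \<and> card S \<le> s}"
    unfolding sparse_eig_min_def by (intro Min_in[OF finite_principal_lambda_mins]) blast
  then show thesis using that by blast
qed

section \<open>The empirical loss as a quadratic function\<close>

definition pred_sq :: "nat \<Rightarrow> (nat \<Rightarrow> real ^ 'p) \<Rightarrow> real ^ 'p \<Rightarrow> real" where
  "pred_sq n x \<beta> = emp_mean n (\<lambda>i. (x i \<bullet> \<beta>)\<^sup>2)"

text \<open>Minus half the gradient of \<open>loss\<close>. At \<open>\<theta>0\<close> it is the
  empirical mean of \<open>\<epsilon> i *\<^sub>R x i\<close>.\<close>

definition score :: "nat \<Rightarrow> (nat \<Rightarrow> real ^ 'p) \<Rightarrow> (nat \<Rightarrow> real) \<Rightarrow> real ^ 'p \<Rightarrow> real ^ 'p" where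
  "score n x y \<theta> = emp_mean n (\<lambda>i. (y i - x i \<bullet> \<theta>) *\<^sub>R x i)"

lemma pred_sq_nonneg: "0 \<le> pred_sq n x \<beta>"
  unfolding pred_sq_def by (rule emp_mean_nonneg) simp

lemma loss_nonneg: "0 \<le> loss n x y \<theta>"
  unfolding loss_def by (rule emp_mean_nonneg) simp

lemma score_inner: "score n x y \<theta> \<bullet> \<delta> = emp_mean n (\<lambda>i. (y i - x i \<bullet> \<theta>) * (x i \<bullet> \<delta>))"
  by (simp add: score_def emp_mean_def inner_sum_left)

text \<open>The loss is quadratic, so its second-order expansion is exact around any base
  point.\<close>

lemma loss_add:
  "loss n x y (\<theta> + \<delta>) = loss n x y \<theta> - 2 * (score n x y \<theta> \<bullet> \<delta>) + pred_sq n x \<delta>"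
proof -
  have "loss n x y (\<theta> + \<delta>) = emp_mean n (\<lambda>i. (y i - x i \<bullet> \<theta>)\<^sup>2
      + (- 2) * ((y i - x i \<bullet> \<theta>) * (x i \<bullet> \<delta>)) + (x i \<bullet> \<delta>)\<^sup>2)"
    unfolding loss_def by (rule emp_mean_cong) (simp add: inner_add_right power2_eq_square algebra_simps)
  also have "\<dots> = loss n x y \<theta> - 2 * (score n x y \<theta> \<bullet> \<delta>) + pred_sq n x \<delta>"
    unfolding emp_mean_add emp_mean_mult_left loss_def score_inner pred_sq_def by simp
  finally show ?thesis .
qed

lemma transpose_gram: "transpose (gram n x) = gram n x"
  by (simp add: gram_def transpose_def vec_eq_iff emp_mean_def mult.commute)

lemma gram_quadratic_form: "\<beta> \<bullet> (gram n x *v \<beta>) = pred_sq n x \<beta>"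
proof -
  have g: "gram n x $ j $ k = emp_mean n (\<lambda>i. x i $ j * x i $ k)" for j k
    by (simp add: gram_def emp_mean_def)
  have "\<beta> \<bullet> (gram n x *v \<beta>) = (\<Sum>j\<in>UNIV. \<Sum>k\<in>UNIV. emp_mean n (\<lambda>i. (\<beta> $ j * \<beta> $ k) * (x i $ j * x i $ k)))"
    by (simp add: inner_vec_def matrix_vector_mult_def g emp_mean_mult_left sum_distrib_left mult_ac)
  also have "\<dots> = emp_mean n (\<lambda>i. (x i \<bullet> \<beta>)\<^sup>2)"
    by (simp add: emp_mean_sum[symmetric] inner_vec_def power2_eq_square sum_product mult_ac)
  finally show ?thesis by (simp add: pred_sq_def)
qed

lemma pred_sq_axis:
  assumes "emp_mean n (\<lambda>i. (x i $ j)\<^sup>2) = 1"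
  shows "pred_sq n x (axis j c) = c\<^sup>2"
proof -
  have "pred_sq n x (axis j c) = emp_mean n (\<lambda>i. c\<^sup>2 * (x i $ j)\<^sup>2)"
    by (simp add: pred_sq_def inner_axis power_mult_distrib mult.commute)
  also have "\<dots> = c\<^sup>2" by (simp only: emp_mean_mult_left assms mult_1_right)
  finally show ?thesis .
qed

lemma sparse_eig_min_pred_sq:
  assumes "card (supp \<beta>) \<le> s"
  shows "sparse_eig_min s (gram n x) * (norm \<beta>)\<^sup>2 \<le> pred_sq n x \<beta>"
proof (cases "supp \<beta> = {}")
  case True
  then have "\<beta> = 0" by (auto simp: supp_def vec_eq_iff)
  then show ?thesis by (simp add: pred_sq_nonneg)
next
  case False
  have "sparse_eig_min s (gram n x) * (norm \<beta>)\<^sup>2 \<le> principal_lambda_min (gram n x) (supp \<beta>) * (norm \<beta>)\<^sup>2"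
    by (intro mult_right_mono sparse_eig_min_le False assms) simp
  also have "\<dots> \<le> pred_sq n x \<beta>"
    unfolding gram_quadratic_form[symmetric]
    by (intro principal_lambda_min_le_Rayleigh transpose_gram False subset_refl)
  finally show ?thesis .
qed

text \<open>At an eigenvector for the minimal eigenvalue the form is that eigenvalue times a
  positive number, and the form is a mean of squares.\<close>

lemma sparse_eig_min_gram_nonneg:
  assumes "s \<ge> 1"
  shows "0 \<le> sparse_eig_min s (gram n x)"
proof -
  obtain S where S: "S \<noteq> {}" "sparse_eig_min s (gram n x) = principal_lambda_min (gram n x) S"
    using sparse_eig_min_attained[OF assms] by blast
  define l where "l = principal_lambda_min (gram n x) S"
  obtain v where v: "v \<noteq> 0" "supp v \<subseteq> S" "\<And>j. j \<in> S \<Longrightarrow> (gram n x *v v) $ j = l * v $ j"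
    using principal_eigenvalue_lambda_min[OF transpose_gram S(1)]
    unfolding principal_eigenvalue_iff l_def by blast
  have "pred_sq n x v = (gram n x *v v) \<bullet> v"
    by (simp add: gram_quadratic_form[symmetric] inner_commute)
  also have "\<dots> = l * (v \<bullet> v)"
    unfolding inner_supp[OF v(2)] using v(3) by (simp add: sum_distrib_left mult.assoc)
  finally have "0 \<le> l * (v \<bullet> v)" using pred_sq_nonneg[of n x v] by simp
  moreover have "0 < v \<bullet> v" using v(1) by simp
  ultimately show ?thesis using S(2) by (simp add: l_def zero_le_mult_iff)
qed

text \<open>By the normalization a coordinate vector has Rayleigh quotient 1.\<close>

lemma sparse_eig_min_gram_le_1:
  assumes "s \<ge> 1" and "emp_mean n (\<lambda>i. (x i $ j)\<^sup>2) = 1"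
  shows "sparse_eig_min s (gram n x) \<le> 1"
proof -
  have "supp (axis j (1::real)) = {j}" by (auto simp: supp_def axis_def)
  then show ?thesis
    using sparse_eig_min_pred_sq[of "axis j 1" s n x] assms
    by (simp add: pred_sq_axis norm_axis_1)
qed

section \<open>Least squares over a support\<close>

lemma set_loss_le: "supp \<theta> \<subseteq> S \<Longrightarrow> set_loss n x y S \<le> loss n x y \<theta>"
  unfolding set_loss_def
  by (rule cINF_lower) (auto intro!: bdd_belowI2[of _ 0] loss_nonneg)

lemma set_loss_greatest:
  fixes x :: "nat \<Rightarrow> real ^ 'p"
  assumes "\<And>\<theta>. supp \<theta> \<subseteq> S \<Longrightarrow> c \<le> loss n x y \<theta>"
  shows "c \<le> set_loss n x y S"
proof -
  have "supp (0 :: real ^ 'p) \<subseteq> S" by (simp add: supp_def)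
  then show ?thesis unfolding set_loss_def by (intro cINF_greatest) (use assms in auto)
qed

lemma set_loss_eq:
  "supp \<theta> \<subseteq> S \<Longrightarrow> (\<And>\<beta>. supp \<beta> \<subseteq> S \<Longrightarrow> loss n x y \<theta> \<le> loss n x y \<beta>) \<Longrightarrow>
    set_loss n x y S = loss n x y \<theta>"
  by (intro antisym set_loss_le set_loss_greatest)

lemma least_squares_exists:
  fixes x :: "nat \<Rightarrow> real ^ 'p"
  assumes pos: "\<phi> > 0" and coercive: "\<And>\<beta>. supp \<beta> \<subseteq> S \<Longrightarrow> \<phi> * (norm \<beta>)\<^sup>2 \<le> pred_sq n x \<beta>"
  obtains \<theta> where "supp \<theta> \<subseteq> S" "\<And>\<beta>. supp \<beta> \<subseteq> S \<Longrightarrow> loss n x y \<theta> \<le> loss n x y \<beta>"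
proof -
  define M where "M = loss n x y 0"
  \<comment> \<open>Outside this ball \<open>pred_sq\<close> exceeds \<open>4 * M\<close>, while it
    is at most \<open>2 * M\<close> plus twice the loss; so the loss there exceeds \<open>M\<close>,
    its value at 0.\<close>
  define K where "K = {\<theta> :: real ^ 'p. supp \<theta> \<subseteq> S} \<inter> cball 0 (sqrt (4 * M / \<phi>))"
  have M0: "M \<ge> 0" by (simp add: M_def loss_nonneg)
  have zero: "0 \<in> K" using M0 pos by (simp add: K_def supp_def)
  have "compact K" unfolding K_def by (intro closed_Int_compact closed_supp_subset compact_cball)
  moreover have "continuous_on K (loss n x y)"
    unfolding loss_def emp_mean_def by (intro continuous_intros)
  ultimately obtain \<theta> where \<theta>: "\<theta> \<in> K" "\<And>\<beta>. \<beta> \<in> K \<Longrightarrow> loss n x y \<theta> \<le> loss n x y \<beta>"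
    using continuous_attains_inf[of K "loss n x y"] zero by blast
  have "loss n x y \<theta> \<le> loss n x y \<beta>" if s: "supp \<beta> \<subseteq> S" for \<beta>
  proof (cases "\<beta> \<in> K")
    case False
    then have "sqrt (4 * M / \<phi>) < norm \<beta>" using s by (auto simp: K_def)
    then have "4 * M / \<phi> < (norm \<beta>)\<^sup>2"
      by (meson not_less real_le_rsqrt)
    then have "4 * M < pred_sq n x \<beta>"
      using coercive[OF s] pos by (simp add: field_simps)
    moreover have "pred_sq n x \<beta> \<le> 2 * M + 2 * loss n x y \<beta>"
    proof -
      \<comment> \<open>The difference of the two sides is the square of
        \<open>2 * y i - x i \<bullet> \<beta>\<close>.\<close>
      have "(x i \<bullet> \<beta>)\<^sup>2 \<le> 2 * (y i - x i \<bullet> 0)\<^sup>2 + 2 * (y i - x i \<bullet> \<beta>)\<^sup>2" for i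
        using sum_squares_ge_zero[of "2 * y i - x i \<bullet> \<beta>" 0]
        by (simp add: power2_eq_square algebra_simps)
      then have "pred_sq n x \<beta> \<le> emp_mean n (\<lambda>i. 2 * (y i - x i \<bullet> 0)\<^sup>2 + 2 * (y i - x i \<bullet> \<beta>)\<^sup>2)"
        unfolding pred_sq_def by (rule emp_mean_mono)
      then show ?thesis by (simp only: emp_mean_add emp_mean_mult_left M_def loss_def)
    qed
    ultimately show ?thesis using \<theta>(2)[OF zero] by (simp add: M_def)
  qed (use \<theta> in auto)
  with \<theta>(1) show thesis using that by (auto simp: K_def)
qed

context
  fixes n :: nat and x :: "nat \<Rightarrow> real ^ 'p" and y :: "nat \<Rightarrow> real"
    and \<theta> :: "real ^ 'p" and S :: "'p set"
  assumes normalized: "\<And>j. emp_mean n (\<lambda>i. (x i $ j)\<^sup>2) = 1"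
    and supp: "supp \<theta> \<subseteq> S"
    and least: "\<And>\<beta>. supp \<beta> \<subseteq> S \<Longrightarrow> loss n x y \<theta> \<le> loss n x y \<beta>"
begin

text \<open>The normalization gives unit curvature along each coordinate, so moving by the score is
  an exact line search.\<close>

lemma loss_add_axis:
  "loss n x y (\<theta> + axis j (score n x y \<theta> $ j)) = loss n x y \<theta> - (score n x y \<theta> $ j)\<^sup>2"
  using normalized by (simp add: loss_add pred_sq_axis inner_axis power2_eq_square)

lemma score_least_squares_selected: "j \<in> S \<Longrightarrow> score n x y \<theta> $ j = 0"
proof -
  assume "j \<in> S"
  then have "supp (\<theta> + axis j (score n x y \<theta> $ j)) \<subseteq> S"
    using supp by (auto simp: supp_subset_iff axis_def)
  from least[OF this] show ?thesis by (simp add: loss_add_axis)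
qed

text \<open>The line search along \<open>j\<close> is one competitor on
  \<open>S \<union> {j}\<close>; refitting all coordinates gains at least as much.\<close>

lemma score_least_squares_bound: "(score n x y \<theta> $ j)\<^sup>2 \<le> - incr_loss n x y j S"
proof -
  have "supp (\<theta> + axis j (score n x y \<theta> $ j)) \<subseteq> S \<union> {j}"
    using supp by (auto simp: supp_subset_iff axis_def)
  from set_loss_le[OF this, of n x y] show ?thesis
    by (simp add: loss_add_axis incr_loss_def set_loss_eq[OF supp least])
qed

end

lemma inner_le_l1:
  fixes u v :: "real ^ 'p"
  assumes "supp v \<subseteq> S" and "\<And>j. j \<in> S \<Longrightarrow> \<bar>u $ j\<bar> \<le> c"
  shows "\<bar>u \<bullet> v\<bar> \<le> c * (\<Sum>j\<in>S. \<bar>v $ j\<bar>)"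
proof -
  have "\<bar>u \<bullet> v\<bar> \<le> (\<Sum>j\<in>S. \<bar>u $ j * v $ j\<bar>)"
    unfolding inner_supp[OF assms(1)] by (rule sum_abs)
  also have "\<dots> \<le> (\<Sum>j\<in>S. c * \<bar>v $ j\<bar>)"
    by (intro sum_mono) (auto simp: abs_mult intro!: mult_right_mono assms(2))
  finally show ?thesis by (simp add: sum_distrib_left)
qed

lemma l1_le_sqrt_card_norm:
  fixes v :: "real ^ 'p"
  assumes "supp v \<subseteq> S"
  shows "(\<Sum>j\<in>S. \<bar>v $ j\<bar>) \<le> sqrt (card S) * norm v"
proof (rule power2_le_imp_le)
  have "(\<Sum>j\<in>S. \<bar>v $ j\<bar>)\<^sup>2 \<le> (\<Sum>j\<in>S. \<bar>v $ j\<bar>\<^sup>2) * card S"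
    by (rule sum_squared_le_sum_of_squares)
  then show "(\<Sum>j\<in>S. \<bar>v $ j\<bar>)\<^sup>2 \<le> (sqrt (card S) * norm v)\<^sup>2"
    by (simp add: power_mult_distrib norm_supp[OF assms] mult.commute)
qed (simp add: sum_nonneg)

section \<open>Forward selection\<close>

text \<open>Each selection removes an index from the complement, so the passes cannot run out while
  an index is left: the loop ends by the stopping rule or with everything selected.\<close>

lemma forward_loop_final_incr:
  assumes "forward_loop n x y t k S S'" and "card (- S) \<le> k" and "j \<notin> S'"
  shows "- incr_loss n x y j S' \<le> t"
  using assms
proof (induction rule: forward_loop.induct)
  case (select S i k S')
  have "i \<notin> S" using select.hyps(1) by (simp add: is_arg_max_def)
  then have "card (- (S \<union> {i})) < card (- S)" by (intro psubset_card_mono) auto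
  with select show ?case by simp
qed (auto simp: not_less)

lemma forward_regression_prediction_bound:
  fixes x :: "nat \<Rightarrow> real ^ 'p"
  assumes normalized: "\<And>j. emp_mean n (\<lambda>i. (x i $ j)\<^sup>2) = 1" and t: "t \<ge> 0"
    and sfr: "simple_forward_regression n x y t S \<theta>"
    and noise: "\<And>j. \<bar>score n x y \<theta>0 $ j\<bar> \<le> \<nu>"
    and pos: "\<phi> > 0"
    and eig: "\<And>\<beta>. card (supp \<beta>) \<le> card S + card (supp \<theta>0) \<Longrightarrow> \<phi> * (norm \<beta>)\<^sup>2 \<le> pred_sq n x \<beta>"
  shows "sqrt (pred_sq n x (\<theta>0 - \<theta>))
    \<le> sqrt (real (card S + card (supp \<theta>0))) * \<phi> powr (- 1 / 2) * (\<nu> + sqrt t)"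
proof -
  define \<delta> where "\<delta> = \<theta>0 - \<theta>"
  define N where "N = pred_sq n x \<delta>"
  define T where "T = S \<union> supp \<theta>0"
  define K where "K = sqrt (real (card S + card (supp \<theta>0)))"
  have loop: "forward_loop n x y t CARD('p) {} S"
    and supp: "supp \<theta> \<subseteq> S"
    and least: "\<And>\<beta>. supp \<beta> \<subseteq> S \<Longrightarrow> loss n x y \<theta> \<le> loss n x y \<beta>"
    using sfr by (auto simp: simple_forward_regression_def is_arg_min_def not_less)
  have \<nu>: "0 \<le> \<nu>" using noise[of undefined] by linarith
  have score: "\<bar>score n x y \<theta> $ j\<bar> \<le> sqrt t" for j
  proof (cases "j \<in> S")
    case True
    then show ?thesis using score_least_squares_selected[OF normalized supp least] t by simp
  next
    case False
    have "(score n x y \<theta> $ j)\<^sup>2 \<le> t"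
      using score_least_squares_bound[OF normalized supp least, of j]
        forward_loop_final_incr[OF loop _ False] by simp
    then show ?thesis by (simp add: real_le_rsqrt)
  qed
  have supp_\<delta>: "supp \<delta> \<subseteq> T"
    using supp by (auto simp: T_def \<delta>_def supp_def)
  have cardT: "card T \<le> card S + card (supp \<theta>0)"
    by (simp add: T_def card_Un_le)
  have l1: "(\<Sum>j\<in>T. \<bar>\<delta> $ j\<bar>) \<le> K * norm \<delta>"
  proof -
    have "sqrt (card T) * norm \<delta> \<le> K * norm \<delta>"
      using cardT by (intro mult_right_mono) (auto simp: K_def)
    with l1_le_sqrt_card_norm[OF supp_\<delta>] show ?thesis by linarith
  qed
  \<comment> \<open>Expanding the loss from both ends of the segment between \<open>\<theta>\<close>
    and \<open>\<theta>0\<close> eliminates the loss values.\<close>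
  have "N = score n x y \<theta> \<bullet> \<delta> - score n x y \<theta>0 \<bullet> \<delta>"
  proof -
    have "loss n x y \<theta>0 = loss n x y \<theta> - 2 * (score n x y \<theta> \<bullet> \<delta>) + N"
      using loss_add[of n x y \<theta> \<delta>] by (simp add: \<delta>_def N_def)
    moreover have "loss n x y \<theta> = loss n x y \<theta>0 - 2 * (score n x y \<theta>0 \<bullet> - \<delta>) + pred_sq n x (- \<delta>)"
      using loss_add[of n x y \<theta>0 "- \<delta>"] by (simp add: \<delta>_def)
    moreover have "pred_sq n x (- \<delta>) = N" by (simp add: N_def pred_sq_def)
    ultimately show ?thesis by simp
  qed
  also have "\<dots> \<le> (\<nu> + sqrt t) * (\<Sum>j\<in>T. \<bar>\<delta> $ j\<bar>)"
    using inner_le_l1[OF supp_\<delta> score] inner_le_l1[OF supp_\<delta> noise] unfolding distrib_right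
    by linarith
  also have "\<dots> \<le> (\<nu> + sqrt t) * (K * norm \<delta>)"
    using \<nu> t by (intro mult_left_mono l1) auto
  finally have N: "N \<le> (\<nu> + sqrt t) * (K * norm \<delta>)" .
  have N0: "0 \<le> N" by (simp add: N_def pred_sq_nonneg)
  have "\<phi> * (norm \<delta>)\<^sup>2 \<le> N"
    unfolding N_def using card_mono[OF _ supp_\<delta>] cardT by (intro eig) auto
  then have "sqrt (\<phi> * (norm \<delta>)\<^sup>2) \<le> sqrt N" by simp
  then have nd: "norm \<delta> \<le> sqrt N / sqrt \<phi>"
    using pos by (simp add: real_sqrt_mult field_simps)
  have K0: "0 \<le> K" by (simp add: K_def)
  have "sqrt N * sqrt N \<le> ((\<nu> + sqrt t) * K / sqrt \<phi>) * sqrt N"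
  proof -
    have "(\<nu> + sqrt t) * (K * norm \<delta>) \<le> (\<nu> + sqrt t) * (K * (sqrt N / sqrt \<phi>))"
      using \<nu> t by (intro mult_left_mono nd K0) auto
    with N N0 show ?thesis by (simp add: mult_ac)
  qed
  moreover have "0 \<le> (\<nu> + sqrt t) * K / sqrt \<phi>" using \<nu> t K0 pos by simp
  \<comment> \<open>One factor \<open>sqrt N\<close> is cancelled; for \<open>N = 0\<close> the
    right side is nonnegative.\<close>
  ultimately have "sqrt N \<le> (\<nu> + sqrt t) * K / sqrt \<phi>"
    using N0 mult_right_le_imp_le[of "sqrt N" "sqrt N"] by (cases "N = 0") auto
  moreover have "\<phi> powr (- 1 / 2) = 1 / sqrt \<phi>"
    using pos by (simp add: powr_minus_divide powr_half_sqrt[symmetric])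
  ultimately show ?thesis by (simp add: N_def \<delta>_def K_def mult_ac)
qed

text \<open>One step of the weighted discrete Hardy inequality
  \<open>(\<Sum>i. (A\<^sub>i\<^sup>2 - A\<^sub>i\<^sub>-\<^sub>1\<^sup>2) / B\<^sub>i) \<le> 4 s\<close> for \<open>A\<^sub>i = c\<^sub>1 + \<dots> + c\<^sub>i\<close>, \<open>B\<^sub>i = c\<^sub>1\<^sup>2 + \<dots> + c\<^sub>i\<^sup>2\<close>, in telescoping form.
  If \<open>b = 0\<close> then \<open>a\<^sup>2 / b = 0\<close>.\<close>

lemma hardy_step:
  fixes a b c :: real
  assumes "0 \<le> b" and "0 < c" and "b = 0 \<Longrightarrow> a = 0"
  shows "((a + c)\<^sup>2 - a\<^sup>2) / (b + c\<^sup>2) \<le> 4 + a\<^sup>2 / b - (a + c)\<^sup>2 / (b + c\<^sup>2)"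
proof (cases "b = 0")
  case False
  with assms have b: "b > 0" by simp
  then have D: "b + c\<^sup>2 > 0" by (simp add: add_pos_nonneg)
  \<comment> \<open>Once the last fraction of the claim is moved to the left and denominators are
    cleared, this square is what remains, up to \<open>2 * c\<^sup>2\<close>.\<close>
  have "0 \<le> (2 * b - a * c)\<^sup>2 / b" using b by simp
  also have "\<dots> = 4 * b - 4 * a * c + a\<^sup>2 / b * c\<^sup>2"
    using b by (simp add: power2_eq_square field_simps)
  finally have "4 * a * c \<le> 4 * b + a\<^sup>2 / b * c\<^sup>2" by simp
  moreover have "(4 + a\<^sup>2 / b) * (b + c\<^sup>2) = 4 * b + 4 * c\<^sup>2 + a\<^sup>2 + a\<^sup>2 / b * c\<^sup>2"
    using b by (simp add: distrib_left distrib_right)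
  moreover have "2 * (a + c)\<^sup>2 - a\<^sup>2 = a\<^sup>2 + 4 * a * c + 2 * c\<^sup>2"
    by (simp add: power2_eq_square algebra_simps)
  moreover have "0 \<le> c\<^sup>2" by simp
  ultimately have "2 * (a + c)\<^sup>2 - a\<^sup>2 \<le> (4 + a\<^sup>2 / b) * (b + c\<^sup>2)" by linarith
  then have "(2 * (a + c)\<^sup>2 - a\<^sup>2) / (b + c\<^sup>2) \<le> 4 + a\<^sup>2 / b"
    using D by (simp add: pos_divide_le_eq)
  then show ?thesis by (simp add: diff_divide_distrib)
qed (use assms in simp)

section \<open>Counting false selections with a potential function\<close>

context
  fixes n m :: nat and x :: "nat \<Rightarrow> real ^ 'p" and y :: "nat \<Rightarrow> real"
    and \<theta>0 :: "real ^ 'p" and t \<phi> :: real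
  assumes normalized: "\<And>j. emp_mean n (\<lambda>i. (x i $ j)\<^sup>2) = 1"
    and t_pos: "t > 0" and \<phi>_pos: "\<phi> > 0"
    and eig: "\<And>\<beta>. card (supp \<beta> - supp \<theta>0) \<le> m \<Longrightarrow> \<phi> * (norm \<beta>)\<^sup>2 \<le> pred_sq n x \<beta>"
    and noise: "\<And>j. (score n x y \<theta>0 $ j)\<^sup>2 \<le> \<phi>\<^sup>2 * t / 4"
begin

text \<open>The reference is a fixed vector and not a minimizer, so the value can be negative: a
  large selection also fits the noise.\<close>

definition excess :: "'p set \<Rightarrow> real" where
  "excess S = set_loss n x y S - loss n x y \<theta>0"

definition missed_l1 :: "'p set \<Rightarrow> real" where
  "missed_l1 S = (\<Sum>j\<in>supp \<theta>0 - S. \<bar>\<theta>0 $ j\<bar>)"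

definition missed_sq :: "'p set \<Rightarrow> real" where
  "missed_sq S = (\<Sum>j\<in>supp \<theta>0 - S. (\<theta>0 $ j)\<^sup>2)"

text \<open>Bounds the number of false selections still to come while the excess loss stays positive:
  each false selection lowers it by at least 1, and a true selection does not raise it.\<close>

definition budget :: "'p set \<Rightarrow> real" where
  "budget S = 1 + 4 / \<phi> * (4 * card (supp \<theta>0 - S) - (missed_l1 S)\<^sup>2 / missed_sq S)
    - 4 * (missed_l1 S)\<^sup>2 / (excess S + \<phi> * missed_sq S)"

text \<open>One coordinate can push the loss below that of \<open>\<theta>0\<close> by at most its
  squared score over \<open>\<phi>\<close>, hence by at most \<open>\<phi> * t / 4\<close>. With at
  most \<open>m\<close> false indices, at most \<open>m + card (supp \<theta>0)\<close> coordinates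
  take part.\<close>

definition slack :: real where
  "slack = \<phi> * t * (m + card (supp \<theta>0)) / 4"

lemma missed_nonneg: "0 \<le> missed_l1 S" "0 \<le> missed_sq S"
  by (auto simp: missed_l1_def missed_sq_def intro!: sum_nonneg)

lemma missed_sq_eq_0: "missed_sq S = 0 \<Longrightarrow> missed_l1 S = 0"
  by (auto simp: missed_l1_def missed_sq_def sum_nonneg_eq_0_iff)

lemma missed_l1_sq_le: "(missed_l1 S)\<^sup>2 \<le> card (supp \<theta>0 - S) * missed_sq S"
proof -
  have "(missed_l1 S)\<^sup>2 \<le> (\<Sum>j\<in>supp \<theta>0 - S. \<bar>\<theta>0 $ j\<bar>\<^sup>2) * card (supp \<theta>0 - S)"
    unfolding missed_l1_def by (rule sum_squared_le_sum_of_squares)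
  then show ?thesis by (simp add: missed_sq_def mult.commute)
qed

lemma missed_ratio_le: "(missed_l1 S)\<^sup>2 / missed_sq S \<le> card (supp \<theta>0 - S)"
  using missed_l1_sq_le[of S] missed_nonneg(2)[of S]
  by (cases "missed_sq S = 0") (auto simp: pos_divide_le_eq less_le)

lemma missed_insert:
  assumes "j \<in> supp \<theta>0 - S"
  shows "missed_l1 S = missed_l1 (S \<union> {j}) + \<bar>\<theta>0 $ j\<bar>"
    and "missed_sq S = missed_sq (S \<union> {j}) + \<bar>\<theta>0 $ j\<bar>\<^sup>2"
    and "card (supp \<theta>0 - S) = Suc (card (supp \<theta>0 - (S \<union> {j})))"
proof -
  define F where "F = supp \<theta>0 - (S \<union> {j})"
  have R: "supp \<theta>0 - S = insert j F" "j \<notin> F" using assms by (auto simp: F_def)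
  show "missed_l1 S = missed_l1 (S \<union> {j}) + \<bar>\<theta>0 $ j\<bar>"
    and "missed_sq S = missed_sq (S \<union> {j}) + \<bar>\<theta>0 $ j\<bar>\<^sup>2"
    and "card (supp \<theta>0 - S) = Suc (card (supp \<theta>0 - (S \<union> {j})))"
    unfolding missed_l1_def missed_sq_def F_def[symmetric] R(1) using R(2) by simp_all
qed

lemma missed_insert_false:
  assumes "j \<notin> supp \<theta>0"
  shows "missed_l1 (S \<union> {j}) = missed_l1 S" "missed_sq (S \<union> {j}) = missed_sq S"
    "card (supp \<theta>0 - (S \<union> {j})) = card (supp \<theta>0 - S)"
proof -
  have "supp \<theta>0 - (S \<union> {j}) = supp \<theta>0 - S" using assms by auto
  then show "missed_l1 (S \<union> {j}) = missed_l1 S" "missed_sq (S \<union> {j}) = missed_sq S"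
    "card (supp \<theta>0 - (S \<union> {j})) = card (supp \<theta>0 - S)"
    by (simp_all add: missed_l1_def missed_sq_def)
qed

lemma slack_nonneg: "0 \<le> slack"
  using \<phi>_pos t_pos by (simp add: slack_def)

text \<open>Replacing \<open>pred_sq\<close> by \<open>\<phi>\<close> times the squared norm makes
  the loss difference separate over coordinates; completing the square in each one gives
  \<open>slack\<close>.\<close>

lemma excess_lower:
  assumes card: "card (S - supp \<theta>0) \<le> m"
  shows "- slack \<le> excess S"
proof -
  have "loss n x y \<theta>0 - slack \<le> loss n x y \<theta>" if supp: "supp \<theta> \<subseteq> S" for \<theta>
  proof -
    define \<delta> where "\<delta> = \<theta> - \<theta>0"
    define T where "T = (S - supp \<theta>0) \<union> supp \<theta>0"
    have supp_\<delta>: "supp \<delta> \<subseteq> T" using supp by (auto simp: T_def \<delta>_def supp_def)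
    have "supp \<delta> - supp \<theta>0 \<subseteq> S - supp \<theta>0" using supp_\<delta> by (auto simp: T_def)
    then have "card (supp \<delta> - supp \<theta>0) \<le> m" using card by (meson card_mono finite order_trans)
    then have "\<phi> * (norm \<delta>)\<^sup>2 \<le> pred_sq n x \<delta>" by (rule eig)
    moreover have "card T \<le> m + card (supp \<theta>0)"
      using card_Un_le[of "S - supp \<theta>0" "supp \<theta>0"] card by (simp only: T_def)
    then have "card T * (\<phi> * t / 4) \<le> real (m + card (supp \<theta>0)) * (\<phi> * t / 4)"
      using \<phi>_pos t_pos by (intro mult_right_mono) auto
    then have "- slack \<le> (\<Sum>j\<in>T. - (\<phi> * t / 4))"
      by (simp add: slack_def algebra_simps)
    moreover have "(\<Sum>j\<in>T. - (\<phi> * t / 4)) \<le> (\<Sum>j\<in>T. \<phi> * (\<delta> $ j)\<^sup>2 - 2 * (score n x y \<theta>0 $ j * \<delta> $ j))"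
    proof (rule sum_mono)
      fix j
      define g where "g = score n x y \<theta>0 $ j"
      have "0 \<le> (\<phi> * \<delta> $ j - g)\<^sup>2 / \<phi>" using \<phi>_pos by simp
      also have "\<dots> = \<phi> * (\<delta> $ j)\<^sup>2 - 2 * (g * \<delta> $ j) + g\<^sup>2 / \<phi>"
        using \<phi>_pos by (simp add: power2_eq_square field_simps)
      also have "g\<^sup>2 / \<phi> \<le> \<phi> * t / 4"
        using noise[of j] \<phi>_pos by (simp add: g_def pos_divide_le_eq power2_eq_square mult_ac)
      finally show "- (\<phi> * t / 4) \<le> \<phi> * (\<delta> $ j)\<^sup>2 - 2 * (score n x y \<theta>0 $ j * \<delta> $ j)"
        by (simp add: g_def)
    qed
    moreover have "\<dots> = \<phi> * (norm \<delta>)\<^sup>2 - 2 * (score n x y \<theta>0 \<bullet> \<delta>)"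
      by (simp add: norm_supp[OF supp_\<delta>] inner_supp[OF supp_\<delta>] sum_subtractf sum_distrib_left)
    moreover have "loss n x y \<theta> = loss n x y \<theta>0 - 2 * (score n x y \<theta>0 \<bullet> \<delta>) + pred_sq n x \<delta>"
      using loss_add[of n x y \<theta>0 \<delta>] by (simp add: \<delta>_def)
    ultimately show ?thesis by linarith
  qed
  then have "loss n x y \<theta>0 - slack \<le> set_loss n x y S" by (rule set_loss_greatest)
  then show ?thesis by (simp add: excess_def)
qed

text \<open>For the least squares fit \<open>\<theta>\<close> on \<open>S\<close> with residual \<open>r\<close>, polarization gives
  \<open>excess S + \<parallel>X(\<theta>0 - \<theta>)\<parallel>\<^sup>2 = 2\<langle>r, X\<theta>0\<rangle>\<close>. The noise enters only through \<open>excess\<close>.\<close>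

lemma excess_le_greedy_drop:
  assumes card: "card (S - supp \<theta>0) \<le> m"
    and drop: "\<And>j. j \<notin> S \<Longrightarrow> - incr_loss n x y j S \<le> d"
  shows "excess S + \<phi> * missed_sq S \<le> 2 * sqrt d * missed_l1 S"
proof -
  have card': "card (supp \<beta> - supp \<theta>0) \<le> m" if "supp \<beta> \<subseteq> S \<union> supp \<theta>0" for \<beta>
  proof -
    have "supp \<beta> - supp \<theta>0 \<subseteq> S - supp \<theta>0" using that by auto
    then show ?thesis using card by (meson card_mono finite order_trans)
  qed
  have "\<phi> * (norm \<beta>)\<^sup>2 \<le> pred_sq n x \<beta>" if "supp \<beta> \<subseteq> S" for \<beta>
    using that by (intro eig card') auto
  from least_squares_exists[OF \<phi>_pos this] obtain \<theta> where supp: "supp \<theta> \<subseteq> S"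
    and least: "\<And>\<beta>. supp \<beta> \<subseteq> S \<Longrightarrow> loss n x y \<theta> \<le> loss n x y \<beta>"
    by metis
  define \<delta> where "\<delta> = \<theta>0 - \<theta>"
  define v where "v = (\<chi> j. if j \<in> S then 0 else \<theta>0 $ j)"
  \<comment> \<open>\<open>\<delta>\<close> and \<open>v\<close> differ only on \<open>S\<close>,
    where the score of the least squares fit vanishes.\<close>
  have "score n x y \<theta> \<bullet> \<delta> = score n x y \<theta> \<bullet> v"
    unfolding inner_vec_def
  proof (intro sum.cong refl)
    fix j
    show "score n x y \<theta> $ j \<bullet> \<delta> $ j = score n x y \<theta> $ j \<bullet> v $ j"
      using score_least_squares_selected[OF normalized supp least, of j] supp
      by (auto simp: \<delta>_def v_def supp_subset_iff)
  qed
  also have "\<dots> \<le> sqrt d * (\<Sum>j\<in>supp \<theta>0 - S. \<bar>v $ j\<bar>)"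
  proof (rule order_trans[OF abs_ge_self inner_le_l1])
    show "supp v \<subseteq> supp \<theta>0 - S" by (auto simp: supp_def v_def)
    show "\<bar>score n x y \<theta> $ j\<bar> \<le> sqrt d" if "j \<in> supp \<theta>0 - S" for j
      using score_least_squares_bound[OF normalized supp least, of j] drop[of j] that
      by (intro real_le_rsqrt) auto
  qed
  also have "(\<Sum>j\<in>supp \<theta>0 - S. \<bar>v $ j\<bar>) = missed_l1 S"
    unfolding missed_l1_def by (rule sum.cong) (auto simp: v_def)
  finally have "score n x y \<theta> \<bullet> \<delta> \<le> sqrt d * missed_l1 S" .
  moreover have "\<phi> * missed_sq S \<le> pred_sq n x \<delta>"
  proof -
    have "missed_sq S = (\<Sum>j\<in>supp \<theta>0 - S. (\<delta> $ j)\<^sup>2)"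
      unfolding missed_sq_def
      by (rule sum.cong) (use supp in \<open>auto simp: \<delta>_def supp_subset_iff\<close>)
    also have "\<dots> \<le> (norm \<delta>)\<^sup>2"
      unfolding norm_supp[OF subset_UNIV] by (rule sum_mono2) auto
    finally have "\<phi> * missed_sq S \<le> \<phi> * (norm \<delta>)\<^sup>2" using \<phi>_pos by simp
    also have "\<dots> \<le> pred_sq n x \<delta>"
      by (intro eig card') (use supp in \<open>auto simp: \<delta>_def supp_def\<close>)
    finally show ?thesis .
  qed
  moreover have "loss n x y \<theta>0 = loss n x y \<theta> - 2 * (score n x y \<theta> \<bullet> \<delta>) + pred_sq n x \<delta>"
    using loss_add[of n x y \<theta> \<delta>] by (simp add: \<delta>_def)
  ultimately show ?thesis by (simp add: excess_def set_loss_eq[OF supp least])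
qed

text \<open>Dropping the positive excess from the denominator and applying Cauchy-Schwarz, each
  subtracted term is at most \<open>4 / \<phi>\<close> times the number of missed indices, against a
  positive term with factor \<open>16 / \<phi>\<close>.\<close>

lemma budget_ge_1:
  assumes "0 < excess S"
  shows "1 \<le> budget S"
proof -
  define a b where "a = missed_l1 S" and "b = missed_sq S"
  have "a\<^sup>2 / (excess S + \<phi> * b) \<le> 1 / \<phi> * (a\<^sup>2 / b)"
  proof (cases "b = 0")
    case False
    then have "b > 0" using missed_nonneg(2)[of S] by (simp add: b_def)
    then have "a\<^sup>2 / (excess S + \<phi> * b) \<le> a\<^sup>2 / (\<phi> * b)"
      using assms \<phi>_pos by (intro divide_left_mono mult_pos_pos add_pos_pos) auto
    then show ?thesis by simp
  qed (use missed_sq_eq_0[of S] in \<open>simp add: a_def b_def\<close>)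
  moreover have "1 / \<phi> * (a\<^sup>2 / b) \<le> 1 / \<phi> * card (supp \<theta>0 - S)"
    using missed_ratio_le[of S] \<phi>_pos by (intro mult_left_mono) (auto simp: a_def b_def)
  moreover have "0 \<le> 1 / \<phi> * card (supp \<theta>0 - S)" using \<phi>_pos by simp
  moreover have "budget S = 1 + 16 * (1 / \<phi> * card (supp \<theta>0 - S)) - 4 * (1 / \<phi> * (a\<^sup>2 / b))
      - 4 * (a\<^sup>2 / (excess S + \<phi> * b))"
    by (simp add: budget_def a_def b_def algebra_simps)
  ultimately show ?thesis by linarith
qed

text \<open>In the notation of the proof the budget falls by
  \<open>4 * (q - p) + 4 * (X - W)\<close>. Here \<open>p \<le> q\<close> because the denominator
  shrinks, and \<open>W \<le> X\<close> by \<open>hardy_step\<close>.\<close>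

lemma budget_true_selection:
  assumes j: "j \<in> supp \<theta>0 - S" and pos: "0 < excess (S \<union> {j})"
    and decr: "excess (S \<union> {j}) \<le> excess S"
  shows "budget (S \<union> {j}) \<le> budget S"
proof -
  define a b c where "a = missed_l1 (S \<union> {j})" and "b = missed_sq (S \<union> {j})" and "c = \<bar>\<theta>0 $ j\<bar>"
  define r where "r = real (card (supp \<theta>0 - (S \<union> {j})))"
  have c: "c > 0" using j by (simp add: c_def supp_def)
  have b: "b \<ge> 0" by (simp add: b_def missed_nonneg)
  have a: "a \<ge> 0" by (simp add: a_def missed_nonneg)
  have D: "0 < \<phi> * (b + c\<^sup>2)" using \<phi>_pos b c by (simp add: add_nonneg_pos)
  define E where "E = excess S + \<phi> * (b + c\<^sup>2)"
  define p q P X W where "p = a\<^sup>2 / E" and "q = a\<^sup>2 / (excess (S \<union> {j}) + \<phi> * b)"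
    and "P = 4 / \<phi> * (4 * r - a\<^sup>2 / b)"
    and "X = 1 / \<phi> * (4 + a\<^sup>2 / b - (a + c)\<^sup>2 / (b + c\<^sup>2))"
    and "W = ((a + c)\<^sup>2 - a\<^sup>2) / E"
  have E: "\<phi> * (b + c\<^sup>2) \<le> E" "0 < E"
    using D pos decr by (auto simp: E_def)
  have "((a + c)\<^sup>2 - a\<^sup>2) / E \<le> ((a + c)\<^sup>2 - a\<^sup>2) / (\<phi> * (b + c\<^sup>2))"
    using E D a c by (intro divide_left_mono) (auto intro!: power_mono)
  also have "\<dots> = 1 / \<phi> * (((a + c)\<^sup>2 - a\<^sup>2) / (b + c\<^sup>2))"
    by simp
  also have "\<dots> \<le> 1 / \<phi> * (4 + a\<^sup>2 / b - (a + c)\<^sup>2 / (b + c\<^sup>2))"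
    using \<phi>_pos b c missed_sq_eq_0[of "S \<union> {j}"]
    by (intro mult_left_mono hardy_step) (auto simp: a_def b_def)
  finally have "((a + c)\<^sup>2 - a\<^sup>2) / E \<le> 1 / \<phi> * (4 + a\<^sup>2 / b - (a + c)\<^sup>2 / (b + c\<^sup>2))" .
  moreover have "a\<^sup>2 / E \<le> a\<^sup>2 / (excess (S \<union> {j}) + \<phi> * b)"
  proof (intro divide_left_mono mult_pos_pos E)
    show "0 < excess (S \<union> {j}) + \<phi> * b" using pos \<phi>_pos b by (simp add: add_pos_nonneg)
    show "excess (S \<union> {j}) + \<phi> * b \<le> E"
      using decr \<phi>_pos by (simp add: E_def distrib_left add_mono)
  qed simp
  moreover have "budget S = 1 + 4 / \<phi> * (4 * (r + 1) - (a + c)\<^sup>2 / (b + c\<^sup>2)) - 4 * ((a + c)\<^sup>2 / E)"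
    unfolding budget_def missed_insert[OF j]
    by (simp add: a_def b_def c_def r_def E_def)
  then have "budget S = 1 + 4 / \<phi> * (4 * r - a\<^sup>2 / b) - 4 * (a\<^sup>2 / E)
      + 4 * (1 / \<phi> * (4 + a\<^sup>2 / b - (a + c)\<^sup>2 / (b + c\<^sup>2)) - ((a + c)\<^sup>2 - a\<^sup>2) / E)"
    by (simp add: diff_divide_distrib algebra_simps)
  moreover have "budget (S \<union> {j}) = 1 + 4 / \<phi> * (4 * r - a\<^sup>2 / b)
      - 4 * (a\<^sup>2 / (excess (S \<union> {j}) + \<phi> * b))"
    by (simp add: budget_def a_def b_def r_def)
  ultimately show ?thesis
    unfolding P_def[symmetric] X_def[symmetric] W_def[symmetric] p_def[symmetric] q_def[symmetric]
    by simp
qed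

lemma budget_false_selection:
  assumes card: "card (S - supp \<theta>0) \<le> m" and j: "j \<notin> supp \<theta>0"
    and pos: "0 < excess (S \<union> {j})" and decr: "excess (S \<union> {j}) < excess S"
    and greedy: "\<And>i. i \<notin> S \<Longrightarrow> - incr_loss n x y i S \<le> - incr_loss n x y j S"
  shows "budget (S \<union> {j}) + 1 \<le> budget S"
proof -
  define a b where "a = missed_l1 S" and "b = missed_sq S"
  define Y Y1 where "Y = excess S + \<phi> * b" and "Y1 = excess (S \<union> {j}) + \<phi> * b"
  have b: "b \<ge> 0" and a: "a \<ge> 0" by (simp_all add: a_def b_def missed_nonneg)
  have Y1: "0 < Y1" using pos \<phi>_pos b by (simp add: Y1_def add_pos_nonneg)
  have YY: "Y1 < Y" using decr by (simp add: Y_def Y1_def)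
  have d: "- incr_loss n x y j S = Y - Y1"
    by (simp add: incr_loss_def Y_def Y1_def excess_def)
  have "Y \<le> 2 * sqrt (Y - Y1) * a"
    using excess_le_greedy_drop[OF card, of "Y - Y1"] greedy d by (simp add: Y_def a_def b_def)
  then have "Y\<^sup>2 \<le> (2 * sqrt (Y - Y1) * a)\<^sup>2"
    using Y1 YY by (intro power_mono) auto
  then have "Y * Y \<le> 4 * a\<^sup>2 * (Y - Y1)"
    using YY by (simp add: power_mult_distrib power2_eq_square[of Y] algebra_simps)
  \<comment> \<open>One factor is weakened to \<open>Y1\<close> so that division by
    \<open>Y1 * Y\<close> leaves a difference of reciprocals.\<close>
  moreover have "Y1 * Y \<le> Y * Y" using Y1 YY by (intro mult_right_mono) auto
  ultimately have "Y1 * Y \<le> 4 * a\<^sup>2 * (Y - Y1)" by linarith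
  then have "4 * a\<^sup>2 / Y + 1 \<le> 4 * a\<^sup>2 / Y1"
    using Y1 YY by (simp add: field_simps)
  then show ?thesis
    unfolding budget_def missed_insert_false[OF j] Y_def Y1_def a_def b_def by simp
qed

lemma card_insert_diff_supp:
  assumes "j \<notin> S"
  shows "card ((S \<union> {j}) - supp \<theta>0) = card (S - supp \<theta>0) + (if j \<in> supp \<theta>0 then 0 else 1)"
proof -
  have "(S \<union> {j}) - supp \<theta>0 = (if j \<in> supp \<theta>0 then S - supp \<theta>0 else insert j (S - supp \<theta>0))"
    by auto
  then show ?thesis using assms by simp
qed

text \<open>Every selection lowers the excess by more than \<open>t\<close>, and until the count of
  false indices reaches \<open>m\<close> the excess cannot fall below
  \<open>- slack\<close>.\<close>

lemma false_selections_excess: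
  assumes "forward_loop n x y t k S S'"
    and "m \<le> card (S' - supp \<theta>0)" and "card (S - supp \<theta>0) \<le> m"
  shows "(real m - card (S - supp \<theta>0)) * t \<le> excess S + slack"
  using assms
proof (induction rule: forward_loop.induct)
  case (select S j k S')
  have j: "j \<notin> S" and drop: "t < excess S - excess (S \<union> {j})"
    using select.hyps(1) by (auto simp: is_arg_max_def incr_loss_def excess_def)
  show ?case
  proof (cases "card (S - supp \<theta>0) = m")
    case True
    then show ?thesis using excess_lower[of S] by simp
  next
    case False
    then have "card ((S \<union> {j}) - supp \<theta>0) \<le> m"
      using select.prems(2) card_insert_diff_supp[OF j] by auto
    from select.IH[OF select.prems(1) this] show ?thesis
      using drop t_pos card_insert_diff_supp[OF j]
      by (auto simp: algebra_simps split: if_splits)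
  qed
qed (use excess_lower in \<open>force\<close>)+

text \<open>While the excess is positive the budget pays for false selections; once it is not, the
  count is left to \<open>false_selections_excess\<close>.\<close>

lemma false_selections_budget:
  assumes "forward_loop n x y t k S S'"
    and "m \<le> card (S' - supp \<theta>0)" and "card (S - supp \<theta>0) \<le> m"
  shows "real m - card (S - supp \<theta>0) \<le> slack / t + (if 0 < excess S then budget S else 0)"
proof -
  have triv: "0 \<le> slack / t + (if 0 < excess S then budget S else 0)" for S
    using slack_nonneg t_pos budget_ge_1[of S] by auto
  show ?thesis
    using assms
  proof (induction rule: forward_loop.induct)
    case (finish S)
    then show ?case using triv[of S] by auto
  next
    case (stop S k)
    then show ?case using triv[of S] by auto
  next
    case (select S j k S')
    have j: "j \<notin> S" and drop: "excess (S \<union> {j}) < excess S"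
      and greedy: "\<And>i. i \<notin> S \<Longrightarrow> - incr_loss n x y i S \<le> - incr_loss n x y j S"
      using select.hyps(1) t_pos
      by (force simp: is_arg_max_def incr_loss_def excess_def not_less)+
    show ?case
    proof (cases "card (S - supp \<theta>0) = m \<or> excess S \<le> 0")
      case True
      then show ?thesis
      proof
        assume "card (S - supp \<theta>0) = m"
        then show ?thesis using triv[of S] by simp
      next
        assume nonpos: "excess S \<le> 0"
        have "forward_loop n x y t (Suc k) S S'" using select.hyps by (rule forward_loop.select)
        from false_selections_excess[OF this select.prems]
        have "(real m - card (S - supp \<theta>0)) * t \<le> slack" using nonpos by linarith
        then show ?thesis using nonpos t_pos by (simp add: pos_le_divide_eq)
      qed
    next
      case False
      then have "card ((S \<union> {j}) - supp \<theta>0) \<le> m"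
        using select.prems(2) card_insert_diff_supp[OF j] by auto
      note IH = select.IH[OF select.prems(1) this]
      have pos: "0 < excess S" using False by simp
      show ?thesis
      proof (cases "j \<in> supp \<theta>0")
        case True
        then show ?thesis
          using IH pos drop j budget_true_selection[of j S] budget_ge_1[OF pos]
            card_insert_diff_supp[OF j]
          by (auto split: if_splits)
      next
        case False
        \<comment> \<open>If this very selection makes the excess nonpositive,
          \<open>budget_ge_1\<close> pays for it; this is the reason for the leading 1 in
          \<open>budget\<close>.\<close>
        then show ?thesis
          using IH pos drop budget_false_selection[OF select.prems(2) False _ drop greedy]
            budget_ge_1[OF pos] card_insert_diff_supp[OF j]
          by (auto split: if_splits)
      qed
    qed
  qed
qed

text \<open>Multiplying the count by \<open>\<phi> \<le> 1\<close> gives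
  \<open>3/4 * \<phi> * m \<le> (1/4 + 1 + 16) * s\<close>, and 23 is \<open>69/4\<close> divided by
  \<open>3/4\<close>.\<close>

lemma false_selections_le:
  assumes loop: "forward_loop n x y t k {} S'" and m: "m \<le> card (S' - supp \<theta>0)" and "\<phi> \<le> 1"
  shows "\<phi> * real m \<le> 23 * card (supp \<theta>0)"
proof -
  define s where "s = real (card (supp \<theta>0))"
  have slack: "slack / t = \<phi> * (m + s) / 4" using t_pos by (simp add: slack_def s_def)
  have main: "real m \<le> slack / t + (if 0 < excess {} then budget {} else 0)"
    using false_selections_budget[OF loop m] by simp
  have \<phi>m: "\<phi> * real m \<le> real m" using assms(3) by (simp add: mult_left_le_one_le \<phi>_pos less_imp_le)
  have \<phi>s: "\<phi> * s \<le> s" using assms(3) by (simp add: mult_left_le_one_le \<phi>_pos less_imp_le s_def)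
  show ?thesis
  \<comment> \<open>The additive 1 of the budget is absorbed into \<open>s\<close>, which requires
    \<open>s \<ge> 1\<close>. For empty support the excess starts nonpositive and \<open>m\<close>
    is 0.\<close>
  proof (cases "supp \<theta>0 = {}")
    case True
    then have "excess {} \<le> 0" using set_loss_le[of \<theta>0 "{}" n x y] by (simp add: excess_def)
    then have "real m \<le> \<phi> * m / 4" using main slack True by (simp add: s_def)
    with \<phi>m show ?thesis using True by simp
  next
    case False
    then have s1: "1 \<le> s" by (simp add: s_def Suc_le_eq card_gt_0_iff)
    have "(if 0 < excess {} then budget {} else 0) \<le> 1 + 16 * s / \<phi>"
    proof -
      have "0 \<le> 4 / \<phi> * ((missed_l1 {})\<^sup>2 / missed_sq {})"
        using \<phi>_pos missed_nonneg(2)[of "{}"] by simp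
      moreover have "0 \<le> 4 * (missed_l1 {})\<^sup>2 / (excess {} + \<phi> * missed_sq {})" if "0 < excess {}"
        using \<phi>_pos missed_nonneg(2)[of "{}"] that by simp
      ultimately show ?thesis using \<phi>_pos s1
        by (auto simp: budget_def s_def algebra_simps)
    qed
    with main slack have "real m \<le> \<phi> * (m + s) / 4 + 1 + 16 * s / \<phi>" by linarith
    then have "\<phi> * real m \<le> \<phi> * (\<phi> * (m + s) / 4 + 1 + 16 * s / \<phi>)"
      using \<phi>_pos by simp
    also have "\<dots> = (\<phi> * (\<phi> * m) + \<phi> * (\<phi> * s)) / 4 + \<phi> + 16 * s"
      using \<phi>_pos by (simp add: field_simps)
    also have "\<dots> \<le> (\<phi> * m + s) / 4 + s + 16 * s"
    proof -
      have "\<phi> * (\<phi> * m) \<le> \<phi> * m" "\<phi> * (\<phi> * s) \<le> \<phi> * s"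
        using \<phi>_pos \<phi>m \<phi>s by simp_all
      then show ?thesis using \<phi>s s1 assms(3) by argo
    qed
    finally have "\<phi> * m \<le> 23 * s" using s1 by argo
    then show ?thesis by (simp add: s_def)
  qed
qed

end

theorem theorem1:
  fixes n :: nat and x :: "nat \<Rightarrow> real ^ 'p" and y \<epsilon> :: "nat \<Rightarrow> real"
    and \<theta>0 \<theta>hat :: "real ^ 'p" and S0 Shat :: "'p set" and s0 shat :: nat and t :: real
    and \<phi> :: "nat \<Rightarrow> real" and noise :: real
  assumes model: "\<And>i. i \<in> {1..n} \<Longrightarrow> y i = x i \<bullet> \<theta>0 + \<epsilon> i"
    and S0: "S0 = supp \<theta>0" and s0: "s0 = card S0" and s0_less: "s0 < n"
    and normalized: "\<And>j. emp_mean n (\<lambda>i. (x i $ j)\<^sup>2) = 1"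
    and t_pos: "t > 0"
    and sfr: "simple_forward_regression n x y t Shat \<theta>hat" and shat: "shat = card Shat"
    and \<phi>: "\<And>s. \<phi> s = sparse_eig_min s (gram n x)"
    and noise: "noise = infnorm (emp_mean n (\<lambda>i. \<epsilon> i *\<^sub>R x i))"
  shows "(\<phi> (shat + s0) \<noteq> 0 \<longrightarrow>
           sqrt (emp_mean n (\<lambda>i. (x i \<bullet> \<theta>0 - x i \<bullet> \<theta>hat)\<^sup>2))
             \<le> sqrt (real (shat + s0)) * \<phi> (shat + s0) powr (- 1 / 2) * (2 * noise + sqrt t)) \<and>
         (\<forall>m :: nat. m \<le> card (Shat - S0) \<and> \<phi> (m + s0) \<noteq> 0 \<and>
             sqrt t \<ge> 2 * inverse (\<phi> (m + s0)) * noise \<longrightarrow>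
           real m \<le> 80 * \<phi> (m + s0) powi (- 4) * real s0)"

proof (intro conjI impI allI)
  have score: "score n x y \<theta>0 = emp_mean n (\<lambda>i. \<epsilon> i *\<^sub>R x i)"
    unfolding score_def by (rule emp_mean_cong) (simp add: model)
  have score_le: "\<bar>score n x y \<theta>0 $ j\<bar> \<le> noise" for j
    unfolding noise score by (rule component_le_infnorm_cart)
  have noise0: "0 \<le> noise" using score_le[of undefined] by linarith
  have eig: "\<phi> s * (norm \<beta>)\<^sup>2 \<le> pred_sq n x \<beta>" if "card (supp \<beta>) \<le> s" for s \<beta>
    unfolding \<phi> by (rule sparse_eig_min_pred_sq[OF that])
  have \<phi>_pos: "0 < \<phi> s" if "\<phi> s \<noteq> 0" "s \<ge> 1" for s
    using sparse_eig_min_gram_nonneg[OF that(2), of n x] that(1) by (simp add: \<phi>)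
  have pred: "emp_mean n (\<lambda>i. (x i \<bullet> \<theta>0 - x i \<bullet> \<theta>hat)\<^sup>2) = pred_sq n x (\<theta>0 - \<theta>hat)"
    by (simp add: pred_sq_def inner_diff_right)

  show "sqrt (emp_mean n (\<lambda>i. (x i \<bullet> \<theta>0 - x i \<bullet> \<theta>hat)\<^sup>2))
      \<le> sqrt (real (shat + s0)) * \<phi> (shat + s0) powr (- 1 / 2) * (2 * noise + sqrt t)"
    if nz: "\<phi> (shat + s0) \<noteq> 0"
  \<comment> \<open>\<open>\<phi> 0\<close> is unspecified, so its sign is unknown; in this case
    both sides of the bound are 0.\<close>
  proof (cases "shat + s0 = 0")
    case True
    then have "supp \<theta>0 = {}" "Shat = {}" using S0 s0 shat by auto
    moreover have "supp \<theta>hat \<subseteq> Shat"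
      using sfr by (simp add: simple_forward_regression_def is_arg_min_def)
    ultimately have "\<theta>0 - \<theta>hat = 0" by (auto simp: supp_def vec_eq_iff)
    then show ?thesis unfolding pred using True by (simp add: pred_sq_def emp_mean_def)
  next
    case False
    have "sqrt (pred_sq n x (\<theta>0 - \<theta>hat))
        \<le> sqrt (real (shat + s0)) * \<phi> (shat + s0) powr (- 1 / 2) * (noise + sqrt t)"
      using forward_regression_prediction_bound[OF normalized _ sfr score_le \<phi>_pos[OF nz]]
        eig False t_pos by (simp add: shat s0 S0 Suc_le_eq card_gt_0_iff)
    also have "\<dots> \<le> sqrt (real (shat + s0)) * \<phi> (shat + s0) powr (- 1 / 2) * (2 * noise + sqrt t)"
      using noise0 by (intro mult_left_mono) auto
    finally show ?thesis unfolding pred .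
  qed

  show "real m \<le> 80 * \<phi> (m + s0) powi (- 4) * real s0"
    if H: "m \<le> card (Shat - S0) \<and> \<phi> (m + s0) \<noteq> 0 \<and> sqrt t \<ge> 2 * inverse (\<phi> (m + s0)) * noise" for m
  \<comment> \<open>This also covers \<open>m + s0 = 0\<close>, where \<open>\<phi>\<close> may have
    any sign; the even power keeps the bound nonnegative.\<close>
  proof (cases "m = 0")
    case True
    have "0 \<le> \<phi> (m + s0) powi (- 4)" by (simp add: power_int_minus)
    then show ?thesis using True by simp
  next
    case False
    define f where "f = \<phi> (m + s0)"
    have f: "0 < f" using H False \<phi>_pos by (simp add: f_def)
    have f1: "f \<le> 1"
      using sparse_eig_min_gram_le_1[OF _ normalized, of "m + s0"] False by (simp add: f_def \<phi>)
    have small: "(score n x y \<theta>0 $ j)\<^sup>2 \<le> f\<^sup>2 * t / 4" for j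
    proof -
      have "noise \<le> f * sqrt t / 2" using H f by (simp add: f_def field_simps)
      then have "\<bar>score n x y \<theta>0 $ j\<bar>\<^sup>2 \<le> (f * sqrt t / 2)\<^sup>2"
        using score_le[of j] by (intro power_mono) auto
      then show ?thesis using t_pos by (simp add: power_mult_distrib power_divide)
    qed
    have eig': "f * (norm \<beta>)\<^sup>2 \<le> pred_sq n x \<beta>" if "card (supp \<beta> - supp \<theta>0) \<le> m" for \<beta>
    proof -
      have "card (supp \<beta>) \<le> card (supp \<beta> - supp \<theta>0) + card (supp \<theta>0)"
        using card_Un_le[of "supp \<beta> - supp \<theta>0" "supp \<theta>0"]
          card_mono[of "supp \<beta> - supp \<theta>0 \<union> supp \<theta>0" "supp \<beta>"] by auto
      then show ?thesis unfolding f_def using that by (intro eig) (simp add: s0 S0)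
    qed
    have loop: "forward_loop n x y t CARD('p) {} Shat"
      using sfr by (simp add: simple_forward_regression_def)
    have "f * m \<le> 23 * s0"
      using false_selections_le[OF normalized t_pos f eig' small loop _ f1] H by (simp add: S0 s0)
    then have "real m \<le> 23 * s0 / f" using f by (simp add: field_simps)
    also have "\<dots> \<le> 80 * (1 / f ^ 4) * s0"
    proof -
      \<comment> \<open>The bound obtained has the first inverse power and constant 23;
        \<open>f \<le> 1\<close> weakens it to the stated form.\<close>
      have "f ^ 4 \<le> f ^ 1" using f f1 by (intro power_decreasing) auto
      then have "1 / f \<le> 1 / f ^ 4" using f by (intro divide_left_mono) auto
      then have "23 * real s0 * (1 / f) \<le> 80 * real s0 * (1 / f ^ 4)"
        using f by (intro mult_mono) auto
      then show ?thesis by (simp add: mult_ac)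
    qed
    also have "1 / f ^ 4 = f powi (- 4)"
      by (simp add: power_int_minus divide_inverse)
    finally show ?thesis by (simp add: f_def)
  qed
qed

end
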